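(* Let $\gamma>0$, $s>0$, and let $\mathcal{F}=\mathcal{F}_c-\mathcal{F}_e$ be a fully discrete free energy with $\mathcal{F},\mathcal{F}_c,\mathcal{F}_e:\mathcal{C}_{m\times n}\to\mathbb{R}$. Suppose that $\rho^k\in\mathcal{C}_{\bar m\times\bar n}$ and $\mathbf{u}^k\in\mathcal{C}_{\bar m\times\bar n}\times\mathcal{C}_{\bar m\times\bar n}$, for all $k\ge 0$, are periodic and solve, for $i=1,\dots,m$, $j=1,\dots,n$, the scheme $$\rho^{k+1}_{ij}-\rho^k_{ij}=-s\,\nabla_h\cdot\left(\rho^k_{ij}\mathbf{u}^{k+\frac12}_{ij}\right),$$ $$\rho^k_{ij}(\mathbf{u}^{k+1}_{ij}-\mathbf{u}^k_{ij})=s\left[-\rho^k_{ij}\,\omega^k_{ij}\times\mathbf{u}^{k+\frac12}_{ij}-\frac{\rho^k_{ij}}{2}\nabla_h|\mathbf{u}^{k+1}_{ij}|^2-\rho^k_{ij}\nabla_h\mu^{k+1}_{ij}+\gamma\Delta_h\mathbf{u}^{k+\frac12}_{ij}\right],$$ $$\mu^{k+1}_{ij}=\delta_\rho\mathcal{F}_c[\rho^{k+1}]_{ij}-\delta_\rho\mathcal{F}_e[\rho^k]_{ij},\qquad \omega^k_{ij}=\nabla_h\times\mathbf{u}^k_{ij},$$ where $\mathbf{u}^{k+\frac12}=\frac12(\mathbf{u}^{k+1}+\mathbf{u}^k)$. Then mass is conserved, i.e. $$(\rho^{k+1}\,\|\,1)=(\rho^k\,\|\,1)\qquad\forall k\ge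 0.$$ If in addition $\mathcal{F}=\mathcal{F}_c-\mathcal{F}_e$ satisfies, for all $\phi,\psi$, $$\mathcal{F}[\phi]-\mathcal{F}[\psi]\le\left(\delta_\phi\mathcal{F}_c[\phi]-\delta_\psi\mathcal{F}_e[\psi]\ \|\ \phi-\psi\right),$$ then the scheme is unconditionally energy stable with discrete energy $$\mathcal{E}[\rho^k,\mathbf{u}^k]=\frac12(\rho^k\mathbf{u}^k\,\|\,\mathbf{u}^k)+\mathcal{F}[\rho^k],$$ that is, $\mathcal{E}[\rho^{k+1},\mathbf{u}^{k+1}]\le\mathcal{E}[\rho^k,\mathbf{u}^k]$ for all $k\ge 0$, for any $s>0$.
   Context: Let $h>0$ and let $m,n$ be positive integers with $L_x=mh$, $L_y=nh$. $\mathcal{C}_{m\times n}$ is the space of real grid functions $\phi_{ij}=\phi(ih,jh)$ with $1\le i\le m$, $1\le j\le n$, and $\mathcal{C}_{\bar m\times\bar n}$ that of grid functions with $0\le i\le m+1$, $0\le j\le n+1$ (including ghost points). $\phi\in\mathcal{C}_{\bar m\times\bar n}$ is periodic if $\phi_{m+1,j}=\phi_{1,j}$, $\phi_{0,j}=\phi_{m,j}$ for $1\le j\le n$ and $\phi_{i,n+1}=\phi_{i,1}$, $\phi_{i,0}=\phi_{i,n}$ for $0\le i\le m$; grid functions in $\mathcal{C}_{m\times n}$ (e.g. $\mu^{k+1}$) are extended periodically when ghost values are needed. Inner products: $(\phi\,\|\,\psi)=h^2\sum_{i=1}^m\sum_{j=1}^n\phi_{ij}\psi_{ij}$, and for vectors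 $(\mathbf{u}\,\|\,\mathbf{v})=(u_1\|v_1)+(u_2\|v_2)$. Difference operators, for $\mathbf{u}=(u,v)^T$: $\nabla_h\phi_{ij}=\frac{1}{2h}(\phi_{i+1,j}-\phi_{i-1,j},\ \phi_{i,j+1}-\phi_{i,j-1})^T$; $\nabla_h\cdot\mathbf{u}_{ij}=\frac{1}{2h}(u_{i+1,j}-u_{i-1,j}+v_{i,j+1}-v_{i,j-1})$; $\nabla_h\times\mathbf{u}_{ij}=\frac{1}{2h}(v_{i+1,j}-v_{i-1,j}-u_{i,j+1}+u_{i,j-1})$ (a scalar); $\Delta_h\phi_{ij}=\frac1{h^2}(\phi_{i+1,j}+\phi_{i-1,j}+\phi_{i,j+1}+\phi_{i,j-1}-4\phi_{ij})$, applied componentwise to vectors. For a scalar $\omega$, $\omega\times(u,v)^T=(-\omega v,\omega u)^T$. The discrete gradient $\delta_\rho\mathcal{G}[\rho]$ of $\mathcal{G}:\mathcal{C}_{m\times n}\to\mathbb{R}$ is the grid function with $\frac{d}{d\epsilon}\mathcal{G}[\rho+\epsilon v]\big|_{\epsilon=0}=(\delta_\rho\mathcal{G}[\rho]\,\|\,v)$ for all $v$. *)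

theory Defs
  imports "HOL-Analysis.Analysis"
begin

(* Grid functions are functions of two natural indices.  The centred differences below use the
   index i - 1, which is exact because they are only evaluated at interior points, where
   i >= 1 and j >= 1.  A vector grid function is a grid function with values in real \<times> real. *)

type_synonym 'a gridfun = "nat \<Rightarrow> nat \<Rightarrow> 'a"

(* A grid function on a finite index rectangle is represented by its extension by 0, so that
   each element of the function space has exactly one representative. *)

definition grid_space :: "nat \<Rightarrow> nat \<Rightarrow> ('a::zero) gridfun set" where
  "grid_space m n = {\<phi>. \<forall>i j. \<not> (i \<in> {1..m} \<and> j \<in> {1..n}) \<longrightarrow> \<phi> i j = 0}"

definition ghost_grid_space :: "nat \<Rightarrow> nat \<Rightarrow> ('a::zero) gridfun set" where
  "ghost_grid_space m n =
     {\<phi>. \<forall>i j. \<not> (i \<in> {0..m + 1} \<and> j \<in> {0..n + 1}) \<longrightarrow> \<phi> i j = 0}"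

definition interior_part :: "nat \<Rightarrow> nat \<Rightarrow> ('a::zero) gridfun \<Rightarrow> 'a gridfun" where
  "interior_part m n \<phi> = (\<lambda>i j. if i \<in> {1..m} \<and> j \<in> {1..n} then \<phi> i j else 0)"

definition periodic_grid :: "nat \<Rightarrow> nat \<Rightarrow> 'a gridfun \<Rightarrow> bool" where
  "periodic_grid m n \<phi> \<longleftrightarrow>
     (\<forall>j\<in>{1..n}. \<phi> (m + 1) j = \<phi> 1 j \<and> \<phi> 0 j = \<phi> m j) \<and>
     (\<forall>i\<in>{0..m}. \<phi> i (n + 1) = \<phi> i 1 \<and> \<phi> i 0 = \<phi> i n)"

definition wrap_index :: "nat \<Rightarrow> nat \<Rightarrow> nat" where
  "wrap_index m i = (if i = 0 then m else if i = m + 1 then 1 else i)"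

definition periodic_ext :: "nat \<Rightarrow> nat \<Rightarrow> 'a gridfun \<Rightarrow> 'a gridfun" where
  "periodic_ext m n \<phi> = (\<lambda>i j. \<phi> (wrap_index m i) (wrap_index n j))"

definition grid_inner :: "real \<Rightarrow> nat \<Rightarrow> nat \<Rightarrow> real gridfun \<Rightarrow> real gridfun \<Rightarrow> real" where
  "grid_inner h m n \<phi> \<psi> = h\<^sup>2 * (\<Sum>i=1..m. \<Sum>j=1..n. \<phi> i j * \<psi> i j)"

definition vgrid_inner ::
  "real \<Rightarrow> nat \<Rightarrow> nat \<Rightarrow> (real \<times> real) gridfun \<Rightarrow> (real \<times> real) gridfun \<Rightarrow> real" where
  "vgrid_inner h m n u v =
     grid_inner h m n (\<lambda>i j. fst (u i j)) (\<lambda>i j. fst (v i j)) +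
     grid_inner h m n (\<lambda>i j. snd (u i j)) (\<lambda>i j. snd (v i j))"

definition grad_h :: "real \<Rightarrow> real gridfun \<Rightarrow> (real \<times> real) gridfun" where
  "grad_h h \<phi> i j =
     (1 / (2 * h)) *\<^sub>R (\<phi> (i + 1) j - \<phi> (i - 1) j, \<phi> i (j + 1) - \<phi> i (j - 1))"

definition div_h :: "real \<Rightarrow> (real \<times> real) gridfun \<Rightarrow> real gridfun" where
  "div_h h u i j =
     1 / (2 * h) * (fst (u (i + 1) j) - fst (u (i - 1) j) + snd (u i (j + 1)) - snd (u i (j - 1)))"

definition curl_h :: "real \<Rightarrow> (real \<times> real) gridfun \<Rightarrow> real gridfun" where
  "curl_h h u i j =
     1 / (2 * h) * (snd (u (i + 1) j) - snd (u (i - 1) j) - fst (u i (j + 1)) + fst (u i (j - 1)))"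

(* On real \<times> real the vector operations act componentwise, so this covers the vector Laplacian. *)

definition laplace_h :: "real \<Rightarrow> ('a::real_vector) gridfun \<Rightarrow> 'a gridfun" where
  "laplace_h h \<phi> i j =
     (1 / h\<^sup>2) *\<^sub>R (\<phi> (i + 1) j + \<phi> (i - 1) j + \<phi> i (j + 1) + \<phi> i (j - 1) - 4 *\<^sub>R \<phi> i j)"

definition scalar_cross :: "real \<Rightarrow> real \<times> real \<Rightarrow> real \<times> real" where
  "scalar_cross \<omega> u = (- \<omega> * snd u, \<omega> * fst u)"

definition is_discrete_gradient ::
  "real \<Rightarrow> nat \<Rightarrow> nat \<Rightarrow> (real gridfun \<Rightarrow> real) \<Rightarrow> real gridfun \<Rightarrow> real gridfun \<Rightarrow> bool" where
  "is_discrete_gradient h m n G \<rho> g \<longleftrightarrow>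
     g \<in> grid_space m n \<and>
     (\<forall>v\<in>grid_space m n.
        ((\<lambda>\<epsilon>. G (\<lambda>i j. \<rho> i j + \<epsilon> * v i j)) has_real_derivative grid_inner h m n g v) (at 0))"

definition discrete_gradient ::
  "real \<Rightarrow> nat \<Rightarrow> nat \<Rightarrow> (real gridfun \<Rightarrow> real) \<Rightarrow> real gridfun \<Rightarrow> real gridfun" where
  "discrete_gradient h m n G \<rho> = (THE g. is_discrete_gradient h m n G \<rho> g)"

definition has_discrete_gradients ::
  "real \<Rightarrow> nat \<Rightarrow> nat \<Rightarrow> (real gridfun \<Rightarrow> real) \<Rightarrow> bool" where
  "has_discrete_gradients h m n G \<longleftrightarrow>
     (\<forall>\<rho>\<in>grid_space m n. \<exists>g. is_discrete_gradient h m n G \<rho> g)"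

lemma is_discrete_gradient_unique:
  assumes "h > 0" "is_discrete_gradient h m n G \<rho> g" "is_discrete_gradient h m n G \<rho> g'"
  shows "g = g'"
proof -
  define v where "v = (\<lambda>i j. g i j - g' i j)"
  have gs: "g \<in> grid_space m n" "g' \<in> grid_space m n"
    using assms by (auto simp: is_discrete_gradient_def)
  have v: "v \<in> grid_space m n"
    using gs by (auto simp: grid_space_def v_def)
  have "grid_inner h m n g v = grid_inner h m n g' v"
    using assms(2,3) v unfolding is_discrete_gradient_def by (meson DERIV_unique)
  then have "(\<Sum>i=1..m. \<Sum>j=1..n. g i j * v i j) - (\<Sum>i=1..m. \<Sum>j=1..n. g' i j * v i j) = 0"
    using assms(1) by (simp add: grid_inner_def)
  then have "(\<Sum>i=1..m. \<Sum>j=1..n. (v i j)\<^sup>2) = 0"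
    by (simp add: v_def power2_eq_square sum_subtractf left_diff_distrib)
  then have zero: "\<forall>i\<in>{1..m}. \<forall>j\<in>{1..n}. (v i j)\<^sup>2 = 0"
    by (simp only: sum_nonneg_eq_0_iff sum_nonneg zero_le_power2 finite_atLeastAtMost)
  have "g i j = g' i j" for i j
  proof (cases "i \<in> {1..m} \<and> j \<in> {1..n}")
    case True
    with zero have "(v i j)\<^sup>2 = 0" by blast
    then show ?thesis by (simp add: v_def)
  next
    case False
    then have "g i j = 0" "g' i j = 0"
      using gs unfolding grid_space_def by blast+
    then show ?thesis by simp
  qed
  then show ?thesis by blast
qed

lemma discrete_gradient_eqI:
  assumes "h > 0" "is_discrete_gradient h m n G \<rho> g"
  shows "discrete_gradient h m n G \<rho> = g"
  unfolding discrete_gradient_def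
  using assms is_discrete_gradient_unique by blast

definition half_step :: "(nat \<Rightarrow> (real \<times> real) gridfun) \<Rightarrow> nat \<Rightarrow> (real \<times> real) gridfun" where
  "half_step u k = (\<lambda>i j. (1 / 2) *\<^sub>R (u (k + 1) i j + u k i j))"

definition discrete_energy ::
  "real \<Rightarrow> nat \<Rightarrow> nat \<Rightarrow> (real gridfun \<Rightarrow> real) \<Rightarrow> real gridfun \<Rightarrow> (real \<times> real) gridfun \<Rightarrow> real" where
  "discrete_energy h m n F \<rho> u =
     1 / 2 * vgrid_inner h m n (\<lambda>i j. \<rho> i j *\<^sub>R u i j) u + F (interior_part m n \<rho>)"

end

theory Submission
  imports Defs
begin

text \<open>Testing the momentum equation with \<open>u\<^bsup>k+1/2\<^esup>\<close> kills the rotational term, makes the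
  viscous term nonpositive and turns the two gradient terms, after summation by parts, into
  the discrete divergence of the mass flux tested with \<open>\<bar>u\<^bsup>k+1\<^esup>\<bar>\<^sup>2 / 2 + \<mu>\<^bsup>k+1\<^esup>\<close>.  By the mass
  equation that divergence is the increment of the density: its product with \<open>\<bar>u\<^bsup>k+1\<^esup>\<bar>\<^sup>2 / 2\<close>
  cancels against the same term in the increment of the kinetic energy, and its product with
  \<open>\<mu>\<^bsup>k+1\<^esup>\<close> dominates the increment of the free energy by the splitting inequality.\<close>

lemma sum_shift_periodic:
  fixes f :: "nat \<Rightarrow> 'a::ab_group_add"
  assumes "f (N + 1) = f 1"
  shows "(\<Sum>i=1..N. f (i + 1)) = (\<Sum>i=1..N. f i)"
proof -
  \<comment> \<open>The difference telescopes for every \<open>N\<close>, including the empty sum;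
    periodicity enters only afterwards and makes the two end terms cancel.\<close>
  have "(\<Sum>i=1..N. f (i + 1)) - (\<Sum>i=1..N. f i) = f (N + 1) - f 1"
    by (induction N) (simp_all add: algebra_simps)
  with assms show ?thesis by simp
qed

text \<open>Shifting the product \<open>f i * g (i - 1)\<close> over one period moves the backward
  shift on \<open>g\<close> to a forward shift on \<open>f\<close>; the end terms
  \<open>f (N + 1) * g N\<close> and \<open>f 1 * g 0\<close> agree.\<close>

lemma sum_periodic_shift_left:
  fixes f g :: "nat \<Rightarrow> 'a::comm_ring"
  assumes "f (N + 1) = f 1" and "g 0 = g N"
  shows "(\<Sum>i=1..N. f i * g (i - 1)) = (\<Sum>i=1..N. f (i + 1) * g i)"
  using sum_shift_periodic[of "\<lambda>i. f i * g (i - 1)" N] assms by simp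

text \<open>The shift rule is used twice, with \<open>f\<close> and \<open>g\<close> exchanged. No
  boundary term survives, so the centred difference is skew-adjoint on periodic sequences.\<close>

lemma sum_by_parts_periodic:
  fixes f g :: "nat \<Rightarrow> 'a::comm_ring"
  assumes "f (N + 1) = f 1" "f 0 = f N" "g (N + 1) = g 1" "g 0 = g N"
  shows "(\<Sum>i=1..N. (f (i + 1) - f (i - 1)) * g i) = - (\<Sum>i=1..N. f i * (g (i + 1) - g (i - 1)))"
proof -
  have "(\<Sum>i=1..N. f i * g (i - 1)) = (\<Sum>i=1..N. f (i + 1) * g i)"
    and "(\<Sum>i=1..N. g i * f (i - 1)) = (\<Sum>i=1..N. g (i + 1) * f i)"
    by (intro sum_periodic_shift_left assms)+
  then show ?thesis
    by (simp add: algebra_simps sum_subtractf)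
qed

text \<open>The two mixed products have equal sums by periodicity, so the form is minus the sum of
  the squared forward differences, a discrete Dirichlet energy.\<close>

lemma sum_second_difference_nonpos:
  fixes f :: "nat \<Rightarrow> 'a::linordered_idom"
  assumes "f (N + 1) = f 1" "f 0 = f N"
  shows "(\<Sum>i=1..N. f i * (f (i + 1) + f (i - 1) - 2 * f i)) \<le> 0"
proof -
  have left: "(\<Sum>i=1..N. f i * f (i - 1)) = (\<Sum>i=1..N. f (i + 1) * f i)"
    by (intro sum_periodic_shift_left assms)
  have sq: "(\<Sum>i=1..N. (f (i + 1))\<^sup>2) = (\<Sum>i=1..N. (f i)\<^sup>2)"
    using sum_shift_periodic[of "\<lambda>i. (f i)\<^sup>2" N] assms by simp
  have "(\<Sum>i=1..N. f i * (f (i + 1) + f (i - 1) - 2 * f i)) =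
      (\<Sum>i=1..N. f (i + 1) * f i) + (\<Sum>i=1..N. f i * f (i - 1)) - 2 * (\<Sum>i=1..N. (f i)\<^sup>2)"
    by (simp add: sum_distrib_left sum.distrib sum_subtractf algebra_simps power2_eq_square)
  also have "\<dots> = - (\<Sum>i=1..N. (f (i + 1) - f i)\<^sup>2)"
    unfolding left power2_diff sum.distrib sum_subtractf sq
    by (simp add: sum_distrib_left algebra_simps)
  also have "\<dots> \<le> 0"
    by (simp add: sum_nonneg)
  finally show ?thesis .
qed

lemma periodic_grid_comp:
  assumes "periodic_grid m n \<phi>"
  shows "periodic_grid m n (\<lambda>i j. f (\<phi> i j))"
  using assms by (simp add: periodic_grid_def)

lemma periodic_grid_comp2:
  assumes "periodic_grid m n \<phi>" "periodic_grid m n \<psi>"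
  shows "periodic_grid m n (\<lambda>i j. f (\<phi> i j) (\<psi> i j))"
  using assms by (simp add: periodic_grid_def)

lemma periodic_grid_periodic_ext:
  assumes "m > 0" "n > 0"
  shows "periodic_grid m n (periodic_ext m n \<phi>)"
  using assms by (auto simp: periodic_grid_def periodic_ext_def wrap_index_def)

text \<open>Collects both components into one pointwise inner product, so that the kinetic energy
  can be treated by vector algebra at each grid point.\<close>

lemma vgrid_inner_eq_sum_inner:
  "vgrid_inner h m n u v = h\<^sup>2 * (\<Sum>i=1..m. \<Sum>j=1..n. u i j \<bullet> v i j)"
  by (simp add: vgrid_inner_def grid_inner_def inner_prod_def sum.distrib distrib_left)

text \<open>Summation by parts in \<open>i\<close> on each line of fixed \<open>j\<close>, and in
  \<open>j\<close> on each line of fixed \<open>i\<close>: \<open>div_h\<close> is minus the adjoint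
  of \<open>grad_h\<close> on periodic grid functions.\<close>

lemma sum_div_h_mult:
  assumes "periodic_grid m n v" "periodic_grid m n p"
  shows "(\<Sum>i=1..m. \<Sum>j=1..n. div_h h v i j * p i j) =
    - (\<Sum>i=1..m. \<Sum>j=1..n. v i j \<bullet> grad_h h p i j)"
proof -
  have x: "(\<Sum>i=1..m. (fst (v (i + 1) j) - fst (v (i - 1) j)) * p i j) =
      - (\<Sum>i=1..m. fst (v i j) * (p (i + 1) j - p (i - 1) j))" if "j \<in> {1..n}" for j
    using assms that sum_by_parts_periodic[of "\<lambda>i. fst (v i j)" m "\<lambda>i. p i j"]
    by (simp add: periodic_grid_def)
  have y: "(\<Sum>j=1..n. (snd (v i (j + 1)) - snd (v i (j - 1))) * p i j) =
      - (\<Sum>j=1..n. snd (v i j) * (p i (j + 1) - p i (j - 1)))" if "i \<in> {1..m}" for i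
    using assms that sum_by_parts_periodic[of "\<lambda>j. snd (v i j)" n "\<lambda>j. p i j"]
    by (simp add: periodic_grid_def)
  have X: "(\<Sum>i=1..m. \<Sum>j=1..n. (fst (v (i + 1) j) - fst (v (i - 1) j)) * p i j) =
      - (\<Sum>i=1..m. \<Sum>j=1..n. fst (v i j) * (p (i + 1) j - p (i - 1) j))"
    \<comment> \<open>\<open>x\<close> holds for fixed \<open>j\<close>, so the sum over
      \<open>i\<close> must become the inner one; fixing both ranges keeps the rewriting from
      looping.\<close>
    unfolding sum.swap[of _ "{1..n}" "{1..m}"]
    by (subst sum_negf[symmetric]) (rule sum.cong[OF refl x])
  have Y: "(\<Sum>i=1..m. \<Sum>j=1..n. (snd (v i (j + 1)) - snd (v i (j - 1))) * p i j) =
      - (\<Sum>i=1..m. \<Sum>j=1..n. snd (v i j) * (p i (j + 1) - p i (j - 1)))"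
    by (subst sum_negf[symmetric]) (rule sum.cong[OF refl y])
  have "(\<Sum>i=1..m. \<Sum>j=1..n. div_h h v i j * p i j) = 1 / (2 * h) *
     ((\<Sum>i=1..m. \<Sum>j=1..n. (fst (v (i + 1) j) - fst (v (i - 1) j)) * p i j)
      + (\<Sum>i=1..m. \<Sum>j=1..n. (snd (v i (j + 1)) - snd (v i (j - 1))) * p i j))"
    unfolding sum.distrib[symmetric] sum_distrib_left
    by (intro sum.cong refl) (simp add: div_h_def algebra_simps)
  also have "\<dots> = - (1 / (2 * h) *
     ((\<Sum>i=1..m. \<Sum>j=1..n. fst (v i j) * (p (i + 1) j - p (i - 1) j))
      + (\<Sum>i=1..m. \<Sum>j=1..n. snd (v i j) * (p i (j + 1) - p i (j - 1)))))"
    unfolding X Y by (simp only: distrib_left mult_minus_right minus_add_distrib)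
  also have "\<dots> = - (\<Sum>i=1..m. \<Sum>j=1..n. v i j \<bullet> grad_h h p i j)"
    unfolding sum.distrib[symmetric] sum_distrib_left
    by (intro arg_cong[where f = uminus] sum.cong refl)
      (simp add: grad_h_def inner_prod_def algebra_simps)
  finally show ?thesis .
qed

text \<open>The five-point stencil is the sum of one second difference in each direction, and each
  of these is nonpositive line by line.\<close>

lemma sum_laplace_h_nonpos:
  fixes \<phi> :: "real gridfun"
  assumes "periodic_grid m n \<phi>"
  shows "(\<Sum>i=1..m. \<Sum>j=1..n. \<phi> i j * laplace_h h \<phi> i j) \<le> 0"
proof -
  have "(\<Sum>i=1..m. \<phi> i j * (\<phi> (i + 1) j + \<phi> (i - 1) j - 2 * \<phi> i j)) \<le> 0" if "j \<in> {1..n}" for j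
    using assms that sum_second_difference_nonpos[of "\<lambda>i. \<phi> i j" m]
    by (simp add: periodic_grid_def)
  then have X: "(\<Sum>i=1..m. \<Sum>j=1..n. \<phi> i j * (\<phi> (i + 1) j + \<phi> (i - 1) j - 2 * \<phi> i j)) \<le> 0"
    unfolding sum.swap[of _ "{1..n}" "{1..m}"] by (rule sum_nonpos)
  have "(\<Sum>j=1..n. \<phi> i j * (\<phi> i (j + 1) + \<phi> i (j - 1) - 2 * \<phi> i j)) \<le> 0" if "i \<in> {1..m}" for i
    using assms that sum_second_difference_nonpos[of "\<lambda>j. \<phi> i j" n]
    by (simp add: periodic_grid_def)
  then have Y: "(\<Sum>i=1..m. \<Sum>j=1..n. \<phi> i j * (\<phi> i (j + 1) + \<phi> i (j - 1) - 2 * \<phi> i j)) \<le> 0"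
    by (rule sum_nonpos)
  have "(\<Sum>i=1..m. \<Sum>j=1..n. \<phi> i j * laplace_h h \<phi> i j) = 1 / h\<^sup>2 *
     ((\<Sum>i=1..m. \<Sum>j=1..n. \<phi> i j * (\<phi> (i + 1) j + \<phi> (i - 1) j - 2 * \<phi> i j))
      + (\<Sum>i=1..m. \<Sum>j=1..n. \<phi> i j * (\<phi> i (j + 1) + \<phi> i (j - 1) - 2 * \<phi> i j)))"
    unfolding sum.distrib[symmetric] sum_distrib_left
    by (intro sum.cong refl) (simp add: laplace_h_def algebra_simps)
  also have "\<dots> \<le> 0"
    using X Y by (intro mult_nonneg_nonpos) auto
  finally show ?thesis .
qed

lemma sum_inner_laplace_h_nonpos:
  fixes w :: "(real \<times> real) gridfun"
  assumes "periodic_grid m n w"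
  shows "(\<Sum>i=1..m. \<Sum>j=1..n. w i j \<bullet> laplace_h h w i j) \<le> 0"
proof -
  have "(\<Sum>i=1..m. \<Sum>j=1..n. w i j \<bullet> laplace_h h w i j) =
      (\<Sum>i=1..m. \<Sum>j=1..n. fst (w i j) * laplace_h h (\<lambda>i j. fst (w i j)) i j)
      + (\<Sum>i=1..m. \<Sum>j=1..n. snd (w i j) * laplace_h h (\<lambda>i j. snd (w i j)) i j)"
    unfolding sum.distrib[symmetric]
    by (intro sum.cong refl) (simp add: laplace_h_def inner_prod_def)
  also have "\<dots> \<le> 0"
    by (intro add_nonpos_nonpos sum_laplace_h_nonpos
        periodic_grid_comp[OF assms, of fst] periodic_grid_comp[OF assms, of snd])
  finally show ?thesis .
qed

text \<open>\<open>scalar_cross\<close> is a scaled quarter turn, hence orthogonal to its argument.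
  As a simp rule it removes the rotational term from the tested momentum equation.\<close>

lemma inner_scalar_cross_self [simp]: "w \<bullet> scalar_cross \<omega> w = 0"
  by (simp add: scalar_cross_def inner_prod_def)

lemma interior_part_in_grid_space: "interior_part m n \<phi> \<in> grid_space m n"
  by (simp add: interior_part_def grid_space_def)

theorem theorem5p1:
  fixes h \<gamma> s :: real and m n :: nat
    and F Fc Fe :: "real gridfun \<Rightarrow> real"
    and \<rho> \<mu> \<omega> :: "nat \<Rightarrow> real gridfun"
    and u :: "nat \<Rightarrow> (real \<times> real) gridfun"
  assumes h_pos: "h > 0" and m_pos: "m > 0" and n_pos: "n > 0"
    and gamma_pos: "\<gamma> > 0" and s_pos: "s > 0"
    and F_split: "\<forall>\<phi>\<in>grid_space m n. F \<phi> = Fc \<phi> - Fe \<phi>"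
    and Fc_diff: "has_discrete_gradients h m n Fc"
    and Fe_diff: "has_discrete_gradients h m n Fe"
    and rho_space: "\<forall>k. \<rho> k \<in> ghost_grid_space m n \<and> periodic_grid m n (\<rho> k)"
    and u_space: "\<forall>k. u k \<in> ghost_grid_space m n \<and> periodic_grid m n (u k)"
    and mass_eq: "\<forall>k. \<forall>i\<in>{1..m}. \<forall>j\<in>{1..n}.
      \<rho> (k + 1) i j - \<rho> k i j = - s * div_h h (\<lambda>i j. \<rho> k i j *\<^sub>R half_step u k i j) i j"
    and momentum_eq: "\<forall>k. \<forall>i\<in>{1..m}. \<forall>j\<in>{1..n}.
      \<rho> k i j *\<^sub>R (u (k + 1) i j - u k i j) =
        s *\<^sub>R (- (\<rho> k i j *\<^sub>R scalar_cross (\<omega> k i j) (half_step u k i j))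
              - (\<rho> k i j / 2) *\<^sub>R grad_h h (\<lambda>i j. (norm (u (k + 1) i j))\<^sup>2) i j
              - \<rho> k i j *\<^sub>R grad_h h (periodic_ext m n (\<mu> (k + 1))) i j
              + \<gamma> *\<^sub>R laplace_h h (half_step u k) i j)"
    and mu_eq: "\<forall>k. \<forall>i\<in>{1..m}. \<forall>j\<in>{1..n}.
      \<mu> (k + 1) i j =
        discrete_gradient h m n Fc (interior_part m n (\<rho> (k + 1))) i j
        - discrete_gradient h m n Fe (interior_part m n (\<rho> k)) i j"
    and omega_eq: "\<forall>k. \<forall>i\<in>{1..m}. \<forall>j\<in>{1..n}. \<omega> k i j = curl_h h (u k) i j"
  shows "(\<forall>k. grid_inner h m n (\<rho> (k + 1)) (\<lambda>i j. 1) = grid_inner h m n (\<rho> k) (\<lambda>i j. 1)) \<and>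
    ((\<forall>\<phi>\<in>grid_space m n. \<forall>\<psi>\<in>grid_space m n.
        F \<phi> - F \<psi> \<le> grid_inner h m n
          (\<lambda>i j. discrete_gradient h m n Fc \<phi> i j - discrete_gradient h m n Fe \<psi> i j)
          (\<lambda>i j. \<phi> i j - \<psi> i j))
      \<longrightarrow> (\<forall>k. discrete_energy h m n F (\<rho> (k + 1)) (u (k + 1)) \<le> discrete_energy h m n F (\<rho> k) (u k)))"
proof (intro conjI allI impI)
  define w where "w k = half_step u k" for k
  have per_w: "periodic_grid m n (w k)" for k
    using u_space periodic_grid_comp2[of m n "u (k + 1)" "u k" "\<lambda>a b. (1 / 2) *\<^sub>R (a + b)"]
    by (simp add: w_def half_step_def)
  have per_flux: "periodic_grid m n (\<lambda>i j. \<rho> k i j *\<^sub>R w k i j)" for k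
    using rho_space per_w periodic_grid_comp2[of m n "\<rho> k" "w k" "(*\<^sub>R)"] by simp
  \<comment> \<open>Weak form of the mass equation. The test function \<open>p\<close> is 1 for mass
    conservation, and \<open>q\<close> and \<open>P\<close> below for the energy estimate.\<close>
  have mass: "(\<Sum>i=1..m. \<Sum>j=1..n. (\<rho> (k + 1) i j - \<rho> k i j) * p i j) =
      s * (\<Sum>i=1..m. \<Sum>j=1..n. (\<rho> k i j *\<^sub>R w k i j) \<bullet> grad_h h p i j)"
    if "periodic_grid m n p" for k p
  proof -
    have "(\<Sum>i=1..m. \<Sum>j=1..n. (\<rho> (k + 1) i j - \<rho> k i j) * p i j) =
        - s * (\<Sum>i=1..m. \<Sum>j=1..n. div_h h (\<lambda>i j. \<rho> k i j *\<^sub>R w k i j) i j * p i j)"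
      unfolding sum_distrib_left using mass_eq
      by (intro sum.cong refl) (simp add: w_def)
    then show ?thesis
      unfolding sum_div_h_mult[OF per_flux that] by simp
  qed
  show "grid_inner h m n (\<rho> (k + 1)) (\<lambda>i j. 1) = grid_inner h m n (\<rho> k) (\<lambda>i j. 1)" for k
    \<comment> \<open>The gradient of a constant is the pair \<open>(0, 0)\<close>, which
      \<open>flip: zero_prod_def\<close> folds into the zero vector so that the flux term
      vanishes.\<close>
    using mass[of "\<lambda>i j. 1" k]
    by (simp add: grid_inner_def periodic_grid_def grad_h_def sum_subtractf flip: zero_prod_def)
  fix k
  assume stab: "\<forall>\<phi>\<in>grid_space m n. \<forall>\<psi>\<in>grid_space m n.
        F \<phi> - F \<psi> \<le> grid_inner h m n
          (\<lambda>i j. discrete_gradient h m n Fc \<phi> i j - discrete_gradient h m n Fe \<psi> i j)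
          (\<lambda>i j. \<phi> i j - \<psi> i j)"
  define q where "q = (\<lambda>i j. (norm (u (k + 1) i j))\<^sup>2)"
  define P where "P = periodic_ext m n (\<mu> (k + 1))"
  have per_q: "periodic_grid m n q"
    using u_space periodic_grid_comp[of m n "u (k + 1)" "\<lambda>x. (norm x)\<^sup>2"] by (simp add: q_def)
  have per_P: "periodic_grid m n P"
    unfolding P_def using m_pos n_pos by (rule periodic_grid_periodic_ext)
  have kinetic: "1 / 2 * ((\<rho> (k + 1) i j *\<^sub>R u (k + 1) i j) \<bullet> u (k + 1) i j)
        - 1 / 2 * ((\<rho> k i j *\<^sub>R u k i j) \<bullet> u k i j) =
      1 / 2 * ((\<rho> (k + 1) i j - \<rho> k i j) * q i j)
      - s / 2 * ((\<rho> k i j *\<^sub>R w k i j) \<bullet> grad_h h q i j)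
      - s * ((\<rho> k i j *\<^sub>R w k i j) \<bullet> grad_h h P i j)
      + s * \<gamma> * (w k i j \<bullet> laplace_h h (w k) i j)"
    if "i \<in> {1..m}" "j \<in> {1..n}" for i j
  proof -
    \<comment> \<open>Adding and subtracting half the old density times \<open>q\<close> splits the
      increment; then the new minus the old squared speed is
      \<open>2 * (w k i j \<bullet> (u (k + 1) i j - u k i j))\<close>, as \<open>w\<close> is the
      midpoint. The density increment is thus weighted by the new speed, the one in the scheme's
      gradient term.\<close>
    have "1 / 2 * ((\<rho> (k + 1) i j *\<^sub>R u (k + 1) i j) \<bullet> u (k + 1) i j)
        - 1 / 2 * ((\<rho> k i j *\<^sub>R u k i j) \<bullet> u k i j) =
      1 / 2 * ((\<rho> (k + 1) i j - \<rho> k i j) * q i j)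
      + w k i j \<bullet> (\<rho> k i j *\<^sub>R (u (k + 1) i j - u k i j))"
      by (simp add: q_def w_def half_step_def power2_norm_eq_inner inner_commute algebra_simps)
    also have "\<rho> k i j *\<^sub>R (u (k + 1) i j - u k i j) =
        s *\<^sub>R (- (\<rho> k i j *\<^sub>R scalar_cross (\<omega> k i j) (w k i j))
              - (\<rho> k i j / 2) *\<^sub>R grad_h h q i j - \<rho> k i j *\<^sub>R grad_h h P i j
              + \<gamma> *\<^sub>R laplace_h h (w k) i j)"
      using momentum_eq that unfolding w_def q_def P_def by blast
    finally show ?thesis
      by (simp add: algebra_simps)
  qed
  have "1 / 2 * (\<Sum>i=1..m. \<Sum>j=1..n. (\<rho> (k + 1) i j *\<^sub>R u (k + 1) i j) \<bullet> u (k + 1) i j)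
        - 1 / 2 * (\<Sum>i=1..m. \<Sum>j=1..n. (\<rho> k i j *\<^sub>R u k i j) \<bullet> u k i j) =
      1 / 2 * (\<Sum>i=1..m. \<Sum>j=1..n. (\<rho> (k + 1) i j - \<rho> k i j) * q i j)
      - s / 2 * (\<Sum>i=1..m. \<Sum>j=1..n. (\<rho> k i j *\<^sub>R w k i j) \<bullet> grad_h h q i j)
      - s * (\<Sum>i=1..m. \<Sum>j=1..n. (\<rho> k i j *\<^sub>R w k i j) \<bullet> grad_h h P i j)
      + s * \<gamma> * (\<Sum>i=1..m. \<Sum>j=1..n. w k i j \<bullet> laplace_h h (w k) i j)"
    unfolding sum_distrib_left sum_subtractf[symmetric] sum.distrib[symmetric]
    using kinetic by (intro sum.cong refl)
  \<comment> \<open>Tested with \<open>q\<close>, the mass equation makes the first two sums cancel;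
    tested with \<open>P\<close>, it turns the potential term into a density increment.\<close>
  also have "\<dots> = - (\<Sum>i=1..m. \<Sum>j=1..n. (\<rho> (k + 1) i j - \<rho> k i j) * P i j)
      + s * \<gamma> * (\<Sum>i=1..m. \<Sum>j=1..n. w k i j \<bullet> laplace_h h (w k) i j)"
    unfolding mass[OF per_q] mass[OF per_P] by simp
  also have "\<dots> \<le> - (\<Sum>i=1..m. \<Sum>j=1..n. (\<rho> (k + 1) i j - \<rho> k i j) * P i j)"
    using mult_nonneg_nonpos[OF _ sum_inner_laplace_h_nonpos[OF per_w]] gamma_pos s_pos by simp
  \<comment> \<open>So far the sums were unweighted; the factor \<open>h\<^sup>2\<close> turns them
    into grid inner products.\<close>
  finally have "h\<^sup>2 * (1 / 2 * (\<Sum>i=1..m. \<Sum>j=1..n. (\<rho> (k + 1) i j *\<^sub>R u (k + 1) i j) \<bullet> u (k + 1) i j)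
        - 1 / 2 * (\<Sum>i=1..m. \<Sum>j=1..n. (\<rho> k i j *\<^sub>R u k i j) \<bullet> u k i j)) \<le>
      h\<^sup>2 * (- (\<Sum>i=1..m. \<Sum>j=1..n. (\<rho> (k + 1) i j - \<rho> k i j) * P i j))"
    by (rule mult_left_mono) simp
  then have kin: "1 / 2 * vgrid_inner h m n (\<lambda>i j. \<rho> (k + 1) i j *\<^sub>R u (k + 1) i j) (u (k + 1))
        - 1 / 2 * vgrid_inner h m n (\<lambda>i j. \<rho> k i j *\<^sub>R u k i j) (u k) \<le>
      - grid_inner h m n P (\<lambda>i j. \<rho> (k + 1) i j - \<rho> k i j)"
    by (simp add: vgrid_inner_eq_sum_inner grid_inner_def right_diff_distrib mult.commute)
  have "F (interior_part m n (\<rho> (k + 1))) - F (interior_part m n (\<rho> k)) \<le> grid_inner h m n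
      (\<lambda>i j. discrete_gradient h m n Fc (interior_part m n (\<rho> (k + 1))) i j
        - discrete_gradient h m n Fe (interior_part m n (\<rho> k)) i j)
      (\<lambda>i j. interior_part m n (\<rho> (k + 1)) i j - interior_part m n (\<rho> k) i j)"
    using stab interior_part_in_grid_space by blast
  \<comment> \<open>At interior points \<open>wrap_index\<close> and \<open>interior_part\<close>
    change nothing, so the split gradient is \<open>P\<close> by \<open>mu_eq\<close>. The bound is
    then the negative of the one in \<open>kin\<close>, and adding the two gives the energy
    decay.\<close>
  also have "\<dots> = grid_inner h m n P (\<lambda>i j. \<rho> (k + 1) i j - \<rho> k i j)"
    unfolding grid_inner_def using mu_eq
    by (intro arg_cong[where f = "(*) (h\<^sup>2)"] sum.cong refl)
      (simp add: P_def periodic_ext_def wrap_index_def interior_part_def)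
  finally show "discrete_energy h m n F (\<rho> (k + 1)) (u (k + 1)) \<le> discrete_energy h m n F (\<rho> k) (u k)"
    using kin unfolding discrete_energy_def by linarith
qed

end
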